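(* For every $\mathsf{n}$-Smullyan model $M$, the following two properties are equivalent: (F-Tarski$^+$) there is no $M$-predicate $H$ such that $\mathrm{False}_M^+=\Phi_M(H)\cap\mathrm{Sent}_M^+$; (T-Tarski$^+$) there is no $M$-predicate $H$ such that $\mathrm{True}_M^+=\Phi_M(H)\cap\mathrm{Sent}_M^+$.
   Context: For a non-empty set $\Sigma$ of symbols, $\Sigma^\ast$ is the set of all finite strings over $\Sigma$, including the empty string $\epsilon$; $XY$ denotes concatenation. A Smullyan model is a triple $M=(\Sigma_M,\mathrm{Pred}_M,\Phi_M)$ where $\Sigma_M$ is a non-empty set of symbols, $\mathrm{Pred}_M\subseteq\Sigma_M^\ast$ is such that $HX\notin \mathrm{Pred}_M$ for all $H\in\mathrm{Pred}_M$ and $X\in\Sigma_M^\ast\setminus\{\epsilon\}$, and $\Phi_M:\mathrm{Pred}_M\to\mathcal{P}(\Sigma_M^\ast)$ is a function. Elements of $\mathrm{Pred}_M$ are called $M$-predicates. $\mathrm{Sent}_M=\{HX : H\in\mathrm{Pred}_M, X\in\Sigma_M^\ast\}$ is the set of $M$-sentences (the decomposition $HX$ of an $M$-sentence is unique), and $\mathrm{Sent}_M^+=\mathrm{Sent}_M\setminus\mathrm{Pred}_M$. $\mathrm{True}_M=\{HX\in \mathrm{Sent}_M : H\in\mathrm{Pred}_M, X\in\Phi_M(H)\}$, $\mathrm{True}_M^+=\mathrm{True}_M\cap\mathrm{Sent}_M^+$, and $\mathrm{False}_M^+=\mathrm{Sent}_M^+\setminus\mathrm{True}_M^+$. Let $\mathsf{n}$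 be a fixed symbol. A Smullyan model $M$ is an $\mathsf{n}$-Smullyan model if $\mathsf{n}\in\Sigma_M$ and for each $H\in\mathrm{Pred}_M$ we have $\mathsf{n}H\in\mathrm{Pred}_M$ and $\Phi_M(\mathsf{n}H)=\Sigma_M^\ast\setminus\Phi_M(H)$. *)

theory Defs
  imports Main
begin

text \<open>
  The set of strings over \<open>\<Sigma>\<close> is \<^term>\<open>lists \<Sigma>\<close>, with \<^term>\<open>[]\<close> as the empty string.
  The partial function \<open>\<Phi>\<close>, defined on predicates only, is rendered by a total function;
  its values outside \<open>Pred\<close> are unconstrained and are never consulted below.
\<close>

record 'a smullyan =
  Sigma :: "'a set"
  Pred :: "'a list set"
  Phi :: "'a list \<Rightarrow> 'a list set"

definition smullyan_model :: "'a smullyan \<Rightarrow> bool" where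
  "smullyan_model M \<longleftrightarrow>
     Sigma M \<noteq> {} \<and>
     Pred M \<subseteq> lists (Sigma M) \<and>
     (\<forall>H \<in> Pred M. \<forall>X \<in> lists (Sigma M) - {[]}. H @ X \<notin> Pred M) \<and>
     (\<forall>H \<in> Pred M. Phi M H \<subseteq> lists (Sigma M))"

definition Sent :: "'a smullyan \<Rightarrow> 'a list set" where
  "Sent M = {H @ X | H X. H \<in> Pred M \<and> X \<in> lists (Sigma M)}"

definition Sent_plus :: "'a smullyan \<Rightarrow> 'a list set" where
  "Sent_plus M = Sent M - Pred M"

definition True_sent :: "'a smullyan \<Rightarrow> 'a list set" where
  "True_sent M = {H @ X | H X. H @ X \<in> Sent M \<and> H \<in> Pred M \<and> X \<in> Phi M H}"

definition True_plus :: "'a smullyan \<Rightarrow> 'a list set" where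
  "True_plus M = True_sent M \<inter> Sent_plus M"

definition False_plus :: "'a smullyan \<Rightarrow> 'a list set" where
  "False_plus M = Sent_plus M - True_plus M"

definition n_smullyan_model :: "'a \<Rightarrow> 'a smullyan \<Rightarrow> bool" where
  "n_smullyan_model n M \<longleftrightarrow>
     smullyan_model M \<and> n \<in> Sigma M \<and>
     (\<forall>H \<in> Pred M. n # H \<in> Pred M \<and> Phi M (n # H) = lists (Sigma M) - Phi M H)"

definition F_Tarski_plus :: "'a smullyan \<Rightarrow> bool" where
  "F_Tarski_plus M \<longleftrightarrow> \<not> (\<exists>H \<in> Pred M. False_plus M = Phi M H \<inter> Sent_plus M)"

definition T_Tarski_plus :: "'a smullyan \<Rightarrow> bool" where
  "T_Tarski_plus M \<longleftrightarrow> \<not> (\<exists>H \<in> Pred M. True_plus M = Phi M H \<inter> Sent_plus M)"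

end

theory Submission
  imports Defs
begin

text \<open>Prefixing \<open>n\<close> to a predicate complements the set it defines, and
  \<open>False_plus M\<close> and \<open>True_plus M\<close> are complements of each other inside
  \<open>Sent_plus M\<close>. So if \<open>H\<close> cuts out one of them on
  \<open>Sent_plus M\<close>, then \<open>n # H\<close> cuts out the other. The link is
  \<open>Phi_neg_Int_Sent_plus\<close>, which turns negation into complementation relative to
  \<open>Sent_plus M\<close>.\<close>

lemma Sent_plus_subset_lists:
  assumes "smullyan_model M"
  shows "Sent_plus M \<subseteq> lists (Sigma M)"
  using assms unfolding smullyan_model_def Sent_plus_def Sent_def by fastforce

text \<open>Negation complements within all strings over \<open>Sigma M\<close>; since
  \<open>Sent_plus M\<close> consists of such strings, restricting to it gives the relative
  complement.\<close>

lemma Phi_neg_Int_Sent_plus: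
  assumes "n_smullyan_model n M" and "H \<in> Pred M"
  shows "Phi M (n # H) \<inter> Sent_plus M = Sent_plus M - (Phi M H \<inter> Sent_plus M)"
proof -
  have "Sent_plus M \<subseteq> lists (Sigma M)"
    using assms(1) by (simp add: n_smullyan_model_def Sent_plus_subset_lists)
  moreover have "Phi M (n # H) = lists (Sigma M) - Phi M H"
    using assms by (simp add: n_smullyan_model_def)
  ultimately show ?thesis by blast
qed

text \<open>Double complementation, valid because \<open>True_plus M\<close> lies inside
  \<open>Sent_plus M\<close>.\<close>

lemma True_plus_eq_Diff: "True_plus M = Sent_plus M - False_plus M"
  unfolding False_plus_def True_plus_def by blast

theorem proposition3p4:
  fixes n :: 'a and M :: "'a smullyan"
  assumes "n_smullyan_model n M"
  shows "F_Tarski_plus M \<longleftrightarrow> T_Tarski_plus M"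
proof -
  have neg: "n # H \<in> Pred M" if "H \<in> Pred M" for H
    using assms that by (simp add: n_smullyan_model_def)
  have "(\<exists>H \<in> Pred M. False_plus M = Phi M H \<inter> Sent_plus M) \<longleftrightarrow>
        (\<exists>H \<in> Pred M. True_plus M = Phi M H \<inter> Sent_plus M)"
  proof
    assume "\<exists>H \<in> Pred M. False_plus M = Phi M H \<inter> Sent_plus M"
    then obtain H where "H \<in> Pred M" "False_plus M = Phi M H \<inter> Sent_plus M" by blast
    \<comment> \<open>The witness for truth is the negation of the predicate for falsity; the
      converse direction uses the same witness with the roles exchanged.\<close>
    then have "True_plus M = Phi M (n # H) \<inter> Sent_plus M"
      using Phi_neg_Int_Sent_plus[OF assms] True_plus_eq_Diff by metis
    then show "\<exists>H \<in> Pred M. True_plus M = Phi M H \<inter> Sent_plus M"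
      using neg \<open>H \<in> Pred M\<close> by blast
  next
    assume "\<exists>H \<in> Pred M. True_plus M = Phi M H \<inter> Sent_plus M"
    then obtain H where "H \<in> Pred M" "True_plus M = Phi M H \<inter> Sent_plus M" by blast
    then have "False_plus M = Phi M (n # H) \<inter> Sent_plus M"
      using Phi_neg_Int_Sent_plus[OF assms] False_plus_def by metis
    then show "\<exists>H \<in> Pred M. False_plus M = Phi M H \<inter> Sent_plus M"
      using neg \<open>H \<in> Pred M\<close> by blast
  qed
  then show ?thesis
    unfolding F_Tarski_plus_def T_Tarski_plus_def by simp
qed

end
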